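(* Let $n\ge5$ be an integer and let $L_p$ be the Laguerre iteration function of $p_n(z)=z^n-1$. Let $S^1=\{z\in\mathbb{C}:|z|=1\}$ and let $\Theta_1$ be the set of all $re^{i(2k+1)\pi/n}$ with $r>0$ and $k\in\{0,\dots,n-1\}$. If $z_0\in S^1\setminus\Theta_1$, then the sequence of iterates $\{L_p^k(z_0)\}_{k\ge0}$ converges monotonically to the root of $p_n$ nearest to $z_0$, in the sense that $|L_p^k(z_0)|=1$ for all $k$ and the arguments of $L_p^k(z_0)$ monotonically approach the argument of that nearest root. (Explicitly: if $\zeta$ is the nearest root and $z_0=\zeta e^{i\phi_0}$ with $|\phi_0|<\pi/n$, then $L_p^k(z_0)=\zeta e^{i\phi_k}$ with $\phi_k$ a monotone sequence converging to $0$.) If $z_0\in S^1\cap\Theta_1$, then the iterates $L_p^k(z_0)$ converge monotonically (in the same sense) to the nearest root of $p_n$ in the clockwise direction from $z_0$, i.e., to $\zeta=z_0e^{-i\pi/n}$.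
   Context: $\sqrt{w}$ denotes the principal square root: if $w=\rho e^{i\phi}$ with $\rho>0$ and $-\pi<\phi\le\pi$, then $\sqrt{w}=\sqrt{\rho}\,e^{i\phi/2}$. The Laguerre iteration function of $p_n(z)=z^n-1$ is $$L_p(z)=z\,\frac{\frac{1}{\sqrt{z^n}}+(n-1)}{\sqrt{z^n}+(n-1)},\qquad z\in\mathbb{C}\setminus\{0\},$$ and $L_p^k$ denotes its $k$-th iterate ($L_p^0$ is the identity). *)

theory Defs
  imports "HOL-Analysis.Analysis" "HOL-Computational_Algebra.Polynomial"
begin

definition unity_poly :: "nat \<Rightarrow> complex poly" where
  "unity_poly n = monom 1 n - 1"

(* Library csqrt is the principal square root with arguments in (-pi, pi];
   in particular csqrt (-1) = \<i>. *)
definition laguerre :: "nat \<Rightarrow> complex \<Rightarrow> complex" where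
  "laguerre n z =
     z * ((1 / csqrt (z ^ n) + (of_nat n - 1)) / (csqrt (z ^ n) + (of_nat n - 1)))"

definition Theta1 :: "nat \<Rightarrow> complex set" where
  "Theta1 n = {of_real r * cis ((2 * real k + 1) * pi / real n) | r k. r > 0 \<and> k < n}"

(* The strict inequality makes the nearest root unique. *)
definition nearest_root :: "complex poly \<Rightarrow> complex \<Rightarrow> complex \<Rightarrow> bool" where
  "nearest_root p z \<zeta> \<longleftrightarrow>
     poly p \<zeta> = 0 \<and> (\<forall>\<omega>. poly p \<omega> = 0 \<and> \<omega> \<noteq> \<zeta> \<longrightarrow> dist z \<zeta> < dist z \<omega>)"

(* \<zeta> is the first root met when z is rotated clockwise about the origin. *)
definition nearest_root_clockwise :: "complex poly \<Rightarrow> complex \<Rightarrow> complex \<Rightarrow> bool" where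
  "nearest_root_clockwise p z \<zeta> \<longleftrightarrow>
     (\<exists>t\<ge>0. \<zeta> = z * cis (- t) \<and> poly p \<zeta> = 0 \<and>
            (\<forall>s. 0 \<le> s \<and> s < t \<longrightarrow> poly p (z * cis (- s)) \<noteq> 0))"

(* \<phi> k is the argument of X k relative to \<zeta>; it is determined modulo 2 pi only, so a
   use of this predicate has to fix the branch through the value of \<phi> 0. Since \<phi> is
   monotone with limit 0, all later values then lie between \<phi> 0 and 0. *)
definition converges_monotonically ::
  "(nat \<Rightarrow> complex) \<Rightarrow> complex \<Rightarrow> (nat \<Rightarrow> real) \<Rightarrow> bool" where
  "converges_monotonically X \<zeta> \<phi> \<longleftrightarrow>
     X \<longlonglongrightarrow> \<zeta> \<and> (\<forall>k. cmod (X k) = 1) \<and>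
     (\<forall>k. X k = \<zeta> * cis (\<phi> k)) \<and> monoseq \<phi> \<and> \<phi> \<longlonglongrightarrow> 0"

end

theory Submission
  imports Defs
begin

text \<open>
  The Laguerre map commutes with the rotations by the \<open>n\<close>-th roots of unity, so a point of the
  unit circle is best described by its angle \<open>\<phi> \<in> (- pi / n, pi / n]\<close> relative to a root \<open>\<zeta>\<close>.
  With \<open>u = cis (n * \<phi> / 2)\<close>, the principal square root of \<open>z ^ n\<close>, the map multiplies
  \<open>z = \<zeta> * cis \<phi>\<close> by \<open>cnj w / w\<close>, where \<open>w = u + (n - 1)\<close>.  This is a rotation by
  \<open>- 2 * Arg w\<close>.  Hence the iteration on the circle is that of a real function, the
  angle map \<open>g \<phi> = \<phi> - 2 * Arg w\<close> (\<open>laguerre_angle_step\<close>).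

  The angle map is odd, so only \<open>\<phi> \<ge> 0\<close> matters.  There \<open>Arg w \<ge> 0\<close>, so angles decrease.
  They do not overshoot the root either: \<open>Arg w \<le> \<phi> / 2\<close> amounts to
  \<open>sin ((n - 1) * x) \<le> (n - 1) * sin x\<close> at \<open>x = \<phi> / 2\<close> (\<open>laguerre_angle_bounds\<close>).  The angles
  therefore have a limit; by continuity it is a fixed point of \<open>g\<close>, and the only
  fixed point in \<open>[0, pi / n]\<close> is \<open>0\<close> (\<open>laguerre_angle_tendsto\<close>).

  The points of \<open>Theta1\<close> on the circle are those with \<open>z ^ n = - 1\<close>.  The principal root of \<open>- 1\<close> is
  \<open>\<i> = cis (pi / 2)\<close>, which is the value of \<open>u\<close> at \<open>\<phi> = pi / n\<close> and not at
  \<open>\<phi> = - pi / n\<close>.  This choice of branch is what sends these points clockwise.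
\<close>

section \<open>The angle map\<close>

definition laguerre_angle :: "nat \<Rightarrow> real \<Rightarrow> real" where
  "laguerre_angle n \<phi> =
     \<phi> - 2 * arctan (sin (real n * \<phi> / 2) / (real n - 1 + cos (real n * \<phi> / 2)))"

lemma laguerre_angle_minus: "laguerre_angle n (- \<phi>) = - laguerre_angle n \<phi>"
  by (simp add: laguerre_angle_def arctan_minus)

lemma funpow_laguerre_angle_minus:
  "(laguerre_angle n ^^ k) (- \<phi>) = - (laguerre_angle n ^^ k) \<phi>"
  by (induction k) (simp_all add: laguerre_angle_minus)

lemma abs_sin_mult_le: "\<bar>sin (real m * x)\<bar> \<le> real m * \<bar>sin x\<bar>"
proof (induction m)
  case (Suc m)
  have "\<bar>sin (real (Suc m) * x)\<bar> = \<bar>sin (real m * x) * cos x + cos (real m * x) * sin x\<bar>"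
    by (simp add: algebra_simps sin_add)
  also have "\<dots> \<le> \<bar>sin (real m * x)\<bar> * \<bar>cos x\<bar> + \<bar>cos (real m * x)\<bar> * \<bar>sin x\<bar>"
    by (metis abs_mult abs_triangle_ineq)
  also have "\<dots> \<le> \<bar>sin (real m * x)\<bar> * 1 + 1 * \<bar>sin x\<bar>"
    by (intro add_mono mult_mono) auto
  also have "\<dots> \<le> real (Suc m) * \<bar>sin x\<bar>"
    using Suc by (simp add: algebra_simps)
  finally show ?case .
qed simp

text \<open>
  Clearing denominators in \<open>tan (Arg w) \<le> tan x\<close>, for \<open>x = \<phi> / 2\<close> and \<open>w = cis (n * x) + (n - 1)\<close>,
  gives \<open>sin (n * x) * cos x - cos (n * x) * sin x \<le> (n - 1) * sin x\<close>, whose left-hand side is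
  \<open>sin ((n - 1) * x)\<close>.
\<close>

lemma laguerre_angle_bounds:
  assumes n: "n \<ge> 2" and "0 \<le> \<phi>" "\<phi> \<le> pi / real n"
  shows "0 \<le> laguerre_angle n \<phi>" "laguerre_angle n \<phi> \<le> \<phi>"
proof -
  define x where "x = \<phi> / 2"
  define d where "d = real n - 1 + cos (real n * x)"
  have nx: "0 \<le> real n * x" "real n * x \<le> pi / 2"
    using assms by (auto simp: x_def field_simps)
  have "2 * x \<le> real n * x"
    using n assms(2) by (intro mult_right_mono) (auto simp: x_def)
  then have x: "0 \<le> x" "x < pi / 2"
    using nx assms(2) pi_gt_zero unfolding x_def by linarith+
  have "0 \<le> cos (real n * x)"
    using nx by (intro cos_ge_zero) auto
  then have d: "d > 0"
    using n by (simp add: d_def)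
  have s: "0 \<le> sin (real n * x)"
    using nx by (intro sin_ge_zero) auto
  have c: "0 < cos x"
    using x by (intro cos_gt_zero_pi) auto
  have eq: "laguerre_angle n \<phi> = \<phi> - 2 * arctan (sin (real n * x) / d)"
    by (simp add: laguerre_angle_def x_def d_def)
  show "laguerre_angle n \<phi> \<le> \<phi>"
    using s d by (simp add: eq)
  have "sin (real n * x) * cos x - cos (real n * x) * sin x = sin (real (n - 1) * x)"
    using n by (simp add: of_nat_diff left_diff_distrib sin_diff)
  also have "\<dots> \<le> real (n - 1) * \<bar>sin x\<bar>"
    using abs_sin_mult_le[of "n - 1" x] by linarith
  also have "\<dots> = (real n - 1) * sin x"
    using n x sin_ge_zero[of x] by (simp add: of_nat_diff)
  finally have "sin (real n * x) * cos x \<le> sin x * d"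
    by (simp add: d_def algebra_simps)
  then have "sin (real n * x) / d \<le> tan x"
    using c d by (simp add: tan_def field_simps)
  then have "arctan (sin (real n * x) / d) \<le> arctan (tan x)"
    by (simp only: arctan_le_iff)
  also have "\<dots> = x"
    using x by (intro arctan_tan) auto
  finally show "0 \<le> laguerre_angle n \<phi>"
    by (simp add: eq x_def)
qed

lemma funpow_laguerre_angle_range:
  assumes "n \<ge> 2" "0 \<le> \<phi>" "\<phi> \<le> pi / real n"
  shows "0 \<le> (laguerre_angle n ^^ k) \<phi> \<and> (laguerre_angle n ^^ k) \<phi> \<le> \<phi>"
proof (induction k)
  case (Suc k)
  then show ?case
    using laguerre_angle_bounds[of n "(laguerre_angle n ^^ k) \<phi>"] assms by auto
qed (use assms in auto)

lemma decseq_laguerre_angle: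
  assumes "n \<ge> 2" "0 \<le> \<phi>" "\<phi> \<le> pi / real n"
  shows "decseq (\<lambda>k. (laguerre_angle n ^^ k) \<phi>)"
proof (rule decseq_SucI)
  fix k
  show "(laguerre_angle n ^^ Suc k) \<phi> \<le> (laguerre_angle n ^^ k) \<phi>"
    using laguerre_angle_bounds(2)[of n "(laguerre_angle n ^^ k) \<phi>"]
      funpow_laguerre_angle_range[OF assms, of k] assms by auto
qed

text \<open>
  A monotone bounded orbit of a continuous map tends to a fixed point.  A fixed point \<open>l\<close> of the
  angle map has \<open>sin (n * l / 2) = 0\<close>, which leaves only \<open>l = 0\<close> in \<open>[0, pi / n]\<close>.
\<close>

lemma laguerre_angle_tendsto:
  assumes n: "n \<ge> 2" and \<phi>: "0 \<le> \<phi>" "\<phi> \<le> pi / real n"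
  shows "(\<lambda>k. (laguerre_angle n ^^ k) \<phi>) \<longlonglongrightarrow> 0"
proof -
  let ?\<phi> = "\<lambda>k. (laguerre_angle n ^^ k) \<phi>"
  note range = funpow_laguerre_angle_range[OF n \<phi>]
  obtain l where l: "?\<phi> \<longlonglongrightarrow> l"
    using decseq_convergent[OF decseq_laguerre_angle[OF n \<phi>], of 0] range by blast
  have l_range: "0 \<le> l" "l \<le> pi / real n"
    using LIMSEQ_le_const[OF l, of 0] LIMSEQ_le_const2[OF l, of \<phi>] range \<phi> by auto
  have nl: "0 \<le> real n * l / 2" "real n * l / 2 \<le> pi / 2"
    using l_range n by (auto simp: field_simps)
  have "0 \<le> cos (real n * l / 2)"
    using nl by (intro cos_ge_zero) auto
  then have d: "real n - 1 + cos (real n * l / 2) > 0"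
    using n by simp
  have "(\<lambda>k. laguerre_angle n (?\<phi> k)) \<longlonglongrightarrow> laguerre_angle n l"
    unfolding laguerre_angle_def[of n "?\<phi> _"] laguerre_angle_def[of n l] using d
    by (intro tendsto_intros l) auto
  moreover have "(\<lambda>k. laguerre_angle n (?\<phi> k)) \<longlonglongrightarrow> l"
    using LIMSEQ_Suc[OF l] by simp
  ultimately have "laguerre_angle n l = l"
    by (rule LIMSEQ_unique)
  then have "sin (real n * l / 2) = 0"
    using d by (simp add: laguerre_angle_def)
  then have "real n * l / 2 = 0"
    using nl sin_gt_zero[of "real n * l / 2"] pi_gt_zero by (cases "real n * l / 2 = 0") auto
  then have "l = 0"
    using n by simp
  then show ?thesis
    using l by simp
qed

section \<open>The Laguerre map on the unit circle\<close>

lemma csqrt_cis_double: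
  assumes "- pi / 2 < \<theta>" "\<theta> \<le> pi / 2"
  shows "csqrt (cis (2 * \<theta>)) = cis \<theta>"
proof (rule csqrt_unique)
  show "(cis \<theta>)\<^sup>2 = cis (2 * \<theta>)"
    by (simp add: power2_eq_square cis_mult)
  show "0 < Re (cis \<theta>) \<or> Re (cis \<theta>) = 0 \<and> 0 \<le> Im (cis \<theta>)"
  proof (cases "\<theta> = pi / 2")
    case False
    then have "cos \<theta> > 0"
      using assms by (intro cos_gt_zero_pi) auto
    then show ?thesis by simp
  next
    case True
    then show ?thesis by (simp del: eq_divide_eq_numeral1)
  qed
qed

lemma cnj_divide_self:
  assumes "Re w > 0"
  shows "cnj w / w = cis (- 2 * arctan (Im w / Re w))"
proof -
  define \<alpha> where "\<alpha> = arctan (Im w / Re w)"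
  have c: "cos \<alpha> > 0"
    using arctan_bounded[of "Im w / Re w"] by (intro cos_gt_zero_pi) (auto simp: \<alpha>_def)
  have "tan \<alpha> = Im w / Re w"
    by (simp add: \<alpha>_def tan_arctan)
  then have w: "w = of_real (Re w / cos \<alpha>) * cis \<alpha>"
    using c assms by (auto simp: complex_eq_iff tan_def field_simps)
  have "cnj w / w = cis (- \<alpha>) / cis \<alpha>"
    using c assms by (subst (1 2) w) (simp add: cis_cnj)
  also have "\<dots> = cis (- 2 * \<alpha>)"
    by (simp add: cis_divide)
  finally show ?thesis by (simp add: \<alpha>_def)
qed

lemma laguerre_angle_step:
  assumes n: "n \<ge> 2" and \<zeta>: "\<zeta> ^ n = 1" and \<phi>: "- pi / real n < \<phi>" "\<phi> \<le> pi / real n"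
  shows "laguerre n (\<zeta> * cis \<phi>) = \<zeta> * cis (laguerre_angle n \<phi>)"
proof -
  define \<theta> where "\<theta> = real n * \<phi> / 2"
  define w where "w = cis \<theta> + (of_nat n - 1)"
  have \<theta>: "- pi / 2 < \<theta>" "\<theta> \<le> pi / 2"
    using n \<phi> by (auto simp: \<theta>_def field_simps)
  have "(\<zeta> * cis \<phi>) ^ n = cis (2 * \<theta>)"
    by (simp add: power_mult_distrib \<zeta> Complex.DeMoivre \<theta>_def)
  then have root: "csqrt ((\<zeta> * cis \<phi>) ^ n) = cis \<theta>"
    using csqrt_cis_double[OF \<theta>] by simp
  have "0 \<le> cos \<theta>"
    using \<theta> by (intro cos_ge_zero) auto
  \<comment> \<open>The real part stays positive because the root of \<open>z ^ n\<close> is the principal one; it lets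
    \<open>arctan\<close> stand for the argument.\<close>
  then have "Re w > 0"
    using n by (simp add: w_def)
  moreover have "1 / cis \<theta> + (of_nat n - 1) = cnj w"
    by (simp add: w_def cis_cnj divide_inverse)
  ultimately have "laguerre n (\<zeta> * cis \<phi>) =
      \<zeta> * cis \<phi> * cis (- 2 * arctan (Im w / Re w))"
    unfolding laguerre_def root using cnj_divide_self[of w] by (simp add: w_def)
  also have "\<dots> = \<zeta> * cis (laguerre_angle n \<phi>)"
    by (simp add: cis_mult laguerre_angle_def w_def \<theta>_def add_ac mult.assoc)
  finally show ?thesis .
qed

lemma laguerre_iterates_converge_monotonically:
  assumes n: "n \<ge> 2" and \<zeta>: "\<zeta> ^ n = 1" and \<phi>: "- pi / real n < \<phi>" "\<phi> \<le> pi / real n"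
  shows "converges_monotonically (\<lambda>k. (laguerre n ^^ k) (\<zeta> * cis \<phi>)) \<zeta>
           (\<lambda>k. (laguerre_angle n ^^ k) \<phi>)"
proof -
  let ?\<phi> = "\<lambda>k. (laguerre_angle n ^^ k) \<phi>"
  have main: "monoseq ?\<phi> \<and> ?\<phi> \<longlonglongrightarrow> 0 \<and> (\<forall>k. - pi / real n < ?\<phi> k \<and> ?\<phi> k \<le> pi / real n)"
  proof (cases "0 \<le> \<phi>")
    case True
    have "- pi / real n < ?\<phi> k \<and> ?\<phi> k \<le> pi / real n" for k
    proof -
      have "- pi / real n < 0" using n by simp
      then show ?thesis
        using funpow_laguerre_angle_range[OF n True \<phi>(2), of k] \<phi> by linarith
    qed
    then show ?thesis
      using decseq_imp_monoseq[OF decseq_laguerre_angle[OF n True \<phi>(2)]]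
        laguerre_angle_tendsto[OF n True \<phi>(2)] by blast
  next
    case False
    then have \<psi>: "0 \<le> - \<phi>" "- \<phi> \<le> pi / real n"
      using \<phi> by auto
    have eq: "?\<phi> k = - (laguerre_angle n ^^ k) (- \<phi>)" for k
      by (simp add: funpow_laguerre_angle_minus)
    have "incseq ?\<phi>"
      using decseq_laguerre_angle[OF n \<psi>] by (simp add: funpow_laguerre_angle_minus decseq_eq_incseq)
    moreover have "?\<phi> \<longlonglongrightarrow> 0"
      using tendsto_minus[OF laguerre_angle_tendsto[OF n \<psi>]]
      by (simp add: funpow_laguerre_angle_minus)
    moreover have "- pi / real n < ?\<phi> k \<and> ?\<phi> k \<le> pi / real n" for k
    proof -
      have "\<phi> \<le> ?\<phi> k" "?\<phi> k \<le> 0"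
        using funpow_laguerre_angle_range[OF n \<psi>, of k] by (auto simp: eq)
      moreover have "0 \<le> pi / real n" by simp
      ultimately show ?thesis using \<phi> by linarith
    qed
    ultimately show ?thesis
      using incseq_imp_monoseq by blast
  qed
  have iter: "(laguerre n ^^ k) (\<zeta> * cis \<phi>) = \<zeta> * cis (?\<phi> k)" for k
  proof (induction k)
    case (Suc k)
    then show ?case
      using laguerre_angle_step[OF n \<zeta>, of "?\<phi> k"] main by simp
  qed simp
  have "norm \<zeta> = 1"
    using power_eq_1_iff[OF \<zeta>] n by simp
  moreover have "(\<lambda>k. \<zeta> * cis (?\<phi> k)) \<longlonglongrightarrow> \<zeta> * cis 0"
    using main by (intro tendsto_mult tendsto_const tendsto_cis) auto
  ultimately show ?thesis
    unfolding converges_monotonically_def using main by (simp add: iter norm_mult)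
qed

section \<open>Roots near a point of the unit circle\<close>

lemma poly_unity_poly_eq_0_iff: "poly (unity_poly n) z = 0 \<longleftrightarrow> z ^ n = 1"
  by (simp add: unity_poly_def poly_monom)

text \<open>
  Every other root sees the point at an angle of absolute value at least \<open>pi / n\<close>: two angles
  smaller than that with the same \<open>n\<close>-fold multiple modulo \<open>2 * pi\<close> are equal.
\<close>

lemma nearest_rootI:
  assumes n: "n > 0" and \<zeta>: "\<zeta> ^ n = 1" and \<phi>: "\<bar>\<phi>\<bar> < pi / real n"
  shows "nearest_root (unity_poly n) (\<zeta> * cis \<phi>) \<zeta>"
proof -
  have norm_root: "norm \<omega> = 1" if "\<omega> ^ n = 1" for \<omega> :: complex
    using power_eq_1_iff[OF that] n by simp
  have dist_sq: "(dist (\<omega> * cis \<gamma>) \<omega>)\<^sup>2 = 2 - 2 * cos \<gamma>" if "\<omega> ^ n = 1" for \<omega> \<gamma>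
  proof -
    have "dist (\<omega> * cis \<gamma>) \<omega> = norm (\<omega> * (cis \<gamma> - 1))"
      by (simp add: dist_norm algebra_simps)
    also have "\<dots> = norm (cis \<gamma> - 1)"
      using norm_root[OF that] by (simp add: norm_mult)
    finally have "(dist (\<omega> * cis \<gamma>) \<omega>)\<^sup>2 = (cos \<gamma> - 1)\<^sup>2 + (sin \<gamma>)\<^sup>2"
      by (simp add: cmod_power2)
    then show ?thesis
      using sin_cos_squared_add[of \<gamma>] by (simp add: power2_eq_square algebra_simps)
  qed
  have "dist (\<zeta> * cis \<phi>) \<zeta> < dist (\<zeta> * cis \<phi>) \<omega>" if \<omega>: "\<omega> ^ n = 1" "\<omega> \<noteq> \<zeta>" for \<omega>
  proof -
    define \<gamma> where "\<gamma> = Arg (\<zeta> * cis \<phi> / \<omega>)"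
    have nz: "\<omega> \<noteq> 0" using norm_root[OF \<omega>(1)] by auto
    have "norm (\<zeta> * cis \<phi> / \<omega>) = 1"
      using norm_root[OF \<zeta>] norm_root[OF \<omega>(1)] by (simp add: norm_mult norm_divide)
    then have "\<zeta> * cis \<phi> / \<omega> = cis \<gamma>"
      unfolding \<gamma>_def by (metis cis_Arg norm_zero sgn_eq div_by_1 of_real_1 zero_neq_one)
    then have z: "\<zeta> * cis \<phi> = \<omega> * cis \<gamma>"
      using nz by (simp add: field_simps)
    have "pi / real n \<le> \<bar>\<gamma>\<bar>"
    proof (rule ccontr)
      assume "\<not> pi / real n \<le> \<bar>\<gamma>\<bar>"
      then have "\<bar>real n * \<gamma>\<bar> < pi" "\<bar>real n * \<phi>\<bar> < pi"
        using n \<phi> by (simp_all add: abs_mult field_simps)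
      moreover have "cis (real n * \<gamma>) = cis (real n * \<phi>)"
        using arg_cong[OF z, of "\<lambda>v. v ^ n"] \<zeta> \<omega> by (simp add: power_mult_distrib Complex.DeMoivre)
      ultimately have "real n * \<gamma> = real n * \<phi>"
        using cis_Arg_unique[of "cis (real n * \<phi>)" "real n * \<gamma>"]
          cis_Arg_unique[of "cis (real n * \<phi>)" "real n * \<phi>"]
        by (metis abs_less_iff less_imp_le minus_less_iff sgn_cis)
      then show False
        using z n \<omega> by simp
    qed
    then have "cos \<bar>\<gamma>\<bar> < cos \<bar>\<phi>\<bar>"
      using \<phi> Arg_le_pi[of "\<zeta> * cis \<phi> / \<omega>"] mpi_less_Arg[of "\<zeta> * cis \<phi> / \<omega>"]
      by (intro cos_monotone_0_pi) (auto simp: \<gamma>_def)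
    then have "(dist (\<zeta> * cis \<phi>) \<zeta>)\<^sup>2 < (dist (\<zeta> * cis \<phi>) \<omega>)\<^sup>2"
      using dist_sq[OF \<zeta>, of \<phi>] dist_sq[OF \<omega>(1), of \<gamma>] by (simp add: z)
    then show ?thesis
      by (rule power2_less_imp_less) simp
  qed
  then show ?thesis
    using \<zeta> by (auto simp: nearest_root_def poly_unity_poly_eq_0_iff)
qed

lemma nearest_root_clockwiseI:
  assumes n: "n > 0" and z: "z ^ n = - 1"
  shows "nearest_root_clockwise (unity_poly n) z (z * cis (- pi / real n))"
proof -
  have "(z * cis (- s)) ^ n \<noteq> 1" if s: "0 \<le> s" "s < pi / real n" for s
  proof
    assume "(z * cis (- s)) ^ n = 1"
    then have "- cis (- (real n * s)) = 1"
      using z by (simp add: power_mult_distrib Complex.DeMoivre)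
    then have "cos (real n * s) = cos pi"
      by (simp add: complex_eq_iff)
    moreover have "cos pi < cos (real n * s)"
      using s n by (intro cos_monotone_0_pi) (auto simp: field_simps)
    ultimately show False by simp
  qed
  moreover have "(z * cis (- pi / real n)) ^ n = 1"
    using n z by (simp add: power_mult_distrib Complex.DeMoivre complex_eq_iff)
  ultimately show ?thesis
    unfolding nearest_root_clockwise_def poly_unity_poly_eq_0_iff
    by (intro exI[of _ "pi / real n"]) auto
qed

lemma power_Theta1:
  assumes "n > 0" "z \<in> sphere 0 1 \<inter> Theta1 n"
  shows "z ^ n = - 1"
proof -
  obtain r k where rk: "z = of_real r * cis ((2 * real k + 1) * pi / real n)" "r > 0"
    using assms(2) by (auto simp: Theta1_def)
  have "r = 1"
    using assms(2) rk by (simp add: norm_mult)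
  then have "z ^ n = cis ((2 * real k + 1) * pi)"
    using rk assms(1) by (simp add: Complex.DeMoivre)
  also have "\<dots> = cis (2 * pi * real k) * cis pi"
    by (subst cis_mult) (simp add: algebra_simps)
  also have "\<dots> = - 1"
    by (simp add: cis_multiple_2pi)
  finally show ?thesis .
qed

text \<open>
  Rounding the angle to the nearest multiple of \<open>2 * pi / n\<close>, with ties rounded down, yields the
  root.  Starting from the argument in \<open>[0, 2 * pi)\<close> makes the index of a tie a natural
  number below \<open>n\<close>, as \<open>Theta1\<close> demands.
\<close>

lemma unit_circle_angle_from_root:
  assumes n: "n > 0" and z: "norm z = 1" "z \<notin> Theta1 n"
  obtains \<zeta> \<phi> where "\<zeta> ^ n = 1" "\<bar>\<phi>\<bar> < pi / real n" "z = \<zeta> * cis \<phi>"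
proof -
  define x where "x = real n * Arg2pi z / (2 * pi)"
  define j where "j = \<lceil>x - 1 / 2\<rceil>"
  define \<phi> where "\<phi> = 2 * pi * (x - of_int j) / real n"
  define \<zeta> where "\<zeta> = cis (2 * pi * of_int j / real n)"
  have x: "0 \<le> x" "x < real n"
    using n Arg2pi_ge_0[of z] Arg2pi_lt_2pi[of z] by (auto simp: x_def field_simps)
  have j: "of_int j < x + 1 / 2" "x - 1 / 2 \<le> of_int j"
    unfolding j_def by linarith+
  have "Arg2pi z = 2 * pi * of_int j / real n + \<phi>"
    using n by (simp add: x_def \<phi>_def field_simps)
  moreover have "z = cis (Arg2pi z)"
    using Arg2pi_eq[of z] z(1) by (simp add: cis_conv_exp)
  ultimately have z_eq: "z = \<zeta> * cis \<phi>"
    by (metis \<zeta>_def cis_mult)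
  have \<zeta>: "\<zeta> ^ n = 1"
    using n by (simp add: \<zeta>_def Complex.DeMoivre cis_multiple_2pi)
  have "x - 1 / 2 \<noteq> of_int j"
  proof
    assume tie: "x - 1 / 2 = of_int j"
    then have "of_int j > (- 1 :: real)" "of_int j < real n"
      using x by linarith+
    then have "0 \<le> j" "nat j < n"
      by linarith+
    moreover have "z = of_real 1 * cis ((2 * real (nat j) + 1) * pi / real n)"
    proof -
      have "\<phi> = pi / real n"
        using tie by (simp add: \<phi>_def algebra_simps flip: tie)
      then show ?thesis
        using z_eq \<open>0 \<le> j\<close> by (simp add: \<zeta>_def cis_mult add_divide_distrib algebra_simps)
    qed
    ultimately have "z \<in> Theta1 n"
      unfolding Theta1_def using zero_less_one by blast
    then show False using z by simp
  qed
  then have "\<bar>x - of_int j\<bar> < 1 / 2"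
    using j by linarith
  then have "2 * pi * \<bar>x - of_int j\<bar> < pi"
    using pi_gt_zero by simp
  then have "\<bar>\<phi>\<bar> < pi / real n"
    using n by (simp add: \<phi>_def abs_mult divide_strict_right_mono)
  then show thesis
    using that \<zeta> z_eq by blast
qed

section \<open>Convergence of the iterates\<close>

theorem proposition6p1:
  fixes n :: nat and z0 :: complex
  assumes "n \<ge> 5"
  shows
    "(z0 \<in> sphere 0 1 - Theta1 n \<longrightarrow>
        (\<exists>\<zeta>. nearest_root (unity_poly n) z0 \<zeta> \<and>
           (\<exists>\<phi>. \<bar>\<phi> 0\<bar> < pi / real n \<and>
              converges_monotonically (\<lambda>k. (laguerre n ^^ k) z0) \<zeta> \<phi>))) \<and>
     (z0 \<in> sphere 0 1 \<inter> Theta1 n \<longrightarrow>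
        (\<exists>\<zeta>. nearest_root_clockwise (unity_poly n) z0 \<zeta> \<and> \<zeta> = z0 * cis (- pi / real n) \<and>
           (\<exists>\<phi>. \<phi> 0 = pi / real n \<and>
              converges_monotonically (\<lambda>k. (laguerre n ^^ k) z0) \<zeta> \<phi>)))"
proof (intro conjI impI)
  have n: "n \<ge> 2" "n > 0" using assms by auto
  {
    assume "z0 \<in> sphere 0 1 - Theta1 n"
    then have "norm z0 = 1" "z0 \<notin> Theta1 n" by auto
    with n(2) obtain \<zeta> \<phi> where *: "\<zeta> ^ n = 1" "\<bar>\<phi>\<bar> < pi / real n" "z0 = \<zeta> * cis \<phi>"
      using unit_circle_angle_from_root by blast
    have "- pi / real n < \<phi>" "\<phi> \<le> pi / real n"
      using *(2) by auto
    from laguerre_iterates_converge_monotonically[OF n(1) *(1) this]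
    show "\<exists>\<zeta>. nearest_root (unity_poly n) z0 \<zeta> \<and>
           (\<exists>\<phi>. \<bar>\<phi> 0\<bar> < pi / real n \<and>
              converges_monotonically (\<lambda>k. (laguerre n ^^ k) z0) \<zeta> \<phi>)"
      using nearest_rootI[OF n(2) *(1,2)] *(2,3)
      by (intro exI[of _ \<zeta>] conjI exI[of _ "\<lambda>k. (laguerre_angle n ^^ k) \<phi>"]) auto
  next
    assume z0: "z0 \<in> sphere 0 1 \<inter> Theta1 n"
    define \<zeta> where "\<zeta> = z0 * cis (- pi / real n)"
    note clockwise = nearest_root_clockwiseI[OF n(2) power_Theta1[OF n(2) z0]]
    have "\<zeta> ^ n = 1"
      using clockwise
      by (auto simp: \<zeta>_def nearest_root_clockwise_def poly_unity_poly_eq_0_iff)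
    moreover have "- pi / real n < pi / real n"
      using n by (simp add: divide_strict_right_mono)
    moreover have "z0 = \<zeta> * cis (pi / real n)"
      by (simp add: \<zeta>_def mult.assoc cis_mult)
    ultimately have "converges_monotonically (\<lambda>k. (laguerre n ^^ k) z0) \<zeta>
        (\<lambda>k. (laguerre_angle n ^^ k) (pi / real n))"
      using laguerre_iterates_converge_monotonically[OF n(1), of \<zeta> "pi / real n"] by simp
    then show "\<exists>\<zeta>. nearest_root_clockwise (unity_poly n) z0 \<zeta> \<and>
         \<zeta> = z0 * cis (- pi / real n) \<and>
           (\<exists>\<phi>. \<phi> 0 = pi / real n \<and>
              converges_monotonically (\<lambda>k. (laguerre n ^^ k) z0) \<zeta> \<phi>)"
      using clockwise
      by (intro exI[of _ \<zeta>] conjI exI[of _ "\<lambda>k. (laguerre_angle n ^^ k) (pi / real n)"])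
        (auto simp: \<zeta>_def)
  }
qed

end
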